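(* Let $y(t)=(y_1(t),\dots,y_N(t))$, $t\in\mathbb{R}$, be a $C^\infty$-smooth $\mathbb{C}^N$-valued function near $t=0$ with $y(0)=0$ satisfying $$t\,\frac{dy_j}{dt}=f_j(t,y(t)),\qquad j=1,\dots,N,$$ where the $f_j(t,y)$ are holomorphic functions in a neighborhood of $(0,0)\in\mathbb{C}\times\mathbb{C}^N$. Then $y(t)$ is real-analytic near $t=0$. *)

theory Defs
  imports "HOL-Analysis.Analysis"
begin

fun iter_vderiv :: "nat \<Rightarrow> (real \<Rightarrow> 'a::real_normed_vector) \<Rightarrow> real \<Rightarrow> 'a" where
  "iter_vderiv 0 g = g"
| "iter_vderiv (Suc k) g = (\<lambda>t. vector_derivative (iter_vderiv k g) (at t))"

definition smooth_on :: "real set \<Rightarrow> (real \<Rightarrow> 'a::real_normed_vector) \<Rightarrow> bool" where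
  "smooth_on S g \<longleftrightarrow> open S \<and> (\<forall>k. \<forall>t\<in>S. iter_vderiv k g differentiable (at t))"

definition real_analytic_on :: "real set \<Rightarrow> (real \<Rightarrow> 'a::real_normed_vector) \<Rightarrow> bool" where
  "real_analytic_on S g \<longleftrightarrow>
     (\<forall>t0\<in>S. \<exists>e>0. \<exists>a::nat \<Rightarrow> 'a. \<forall>t. \<bar>t - t0\<bar> < e \<longrightarrow>
        (\<lambda>k. (t - t0) ^ k *\<^sub>R a k) sums g t)"

text \<open>Holomorphic functions of several complex variables on an open set U of
  C x C^n: complex (Frechet) differentiable at each point of U, i.e. the real
  derivative exists and is complex-linear.\<close>
definition holomorphic_several ::
    "(complex \<times> (complex^'n) \<Rightarrow> complex) \<Rightarrow> (complex \<times> (complex^'n)) set \<Rightarrow> bool" where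
  "holomorphic_several F U \<longleftrightarrow> open U \<and>
     (\<forall>z\<in>U. \<exists>D. (F has_derivative D) (at z) \<and>
        (\<forall>w. D (\<i> * fst w, \<i> *s snd w) = \<i> * D w))"

end

theory Submission
  imports Defs "HOL-Complex_Analysis.Conformal_Mappings"
begin

text \<open>
  Let \<open>L\<close> be a Lipschitz constant of \<open>F = (f\<^sub>1, \<dots>, f\<^sub>N)\<close> in the second variable near the origin, and
  fix \<open>m \<ge> 2 L\<close>. Smoothness gives an entire \<open>p\<close> that agrees with \<open>y\<close> to order \<open>m\<close> at \<open>0\<close>, so the
  residual \<open>F z (p z) - z p'(z)\<close> is \<open>O(t\<^sup>m)\<close> on the real axis and hence, being holomorphic, \<open>O(z\<^sup>m)\<close>
  on a complex disc. The Picard iteration \<open>z W\<^sub>n\<^sub>+\<^sub>1' = F z (W\<^sub>n z)\<close>, \<open>W\<^sub>0 = p\<close>, contracts by the factor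
  \<open>L / m \<le> 1/2\<close> in the weighted norm \<open>sup |w(z)| / |z|\<^sup>m\<close>, because the integral of \<open>L s\<^sup>m\<^sup>-\<^sup>1\<close> over
  \<open>[0,1]\<close> is \<open>L / m\<close>. So it converges to a holomorphic limit on the disc; on the real axis the same
  estimate applied to \<open>y - W\<^sub>n\<close> shows that this limit is \<open>y\<close>.
\<close>

section \<open>Norms and derivatives of vectors through their components\<close>

lemma norm_vector_scalar_mult_complex:
  fixes v :: "complex^'n"
  shows "norm (c *s v) = norm c * norm v"
  by (simp add: norm_vec_def norm_mult L2_set_right_distrib)

lemma norm_le_sum_norm_nth:
  fixes v :: "'a::real_normed_vector^'n"
  shows "norm v \<le> (\<Sum>j\<in>UNIV. norm (v $ j))"
  by (simp add: norm_vec_def L2_set_le_sum)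

lemma bounded_linear_axis: "bounded_linear (axis j :: 'a::real_normed_vector \<Rightarrow> 'a^'n)"
proof (rule bounded_linear_intro[where K = 1])
  fix x :: 'a
  have "norm (axis j x :: 'a^'n) \<le> (\<Sum>i\<in>UNIV. if i = j then norm x else 0)"
    using norm_le_sum_norm_nth[of "axis j x :: 'a^'n"] by (simp add: axis_def if_distrib cong: if_cong)
  then show "norm (axis j x :: 'a^'n) \<le> norm x * 1" by simp
qed (auto simp: vec_eq_iff axis_def)

text \<open>A vector is the finite sum of the \<open>axis j (v $ j)\<close>, and
  \<open>axis j\<close> is bounded linear. This allows work with whole complex components instead of
  real coordinates.\<close>

lemma has_derivative_vec_componentwise:
  fixes f :: "'a::real_normed_vector \<Rightarrow> 'b::real_normed_vector^'n"
  assumes "\<And>j. ((\<lambda>x. f x $ j) has_derivative (\<lambda>h. D h $ j)) F"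
  shows "(f has_derivative D) F"
proof -
  have sum_axis: "v = (\<Sum>j\<in>UNIV. axis j (v $ j))" for v :: "'b^'n"
    by (simp add: vec_eq_iff axis_def sum.delta if_distrib cong: if_cong)
  have "((\<lambda>x. \<Sum>j\<in>UNIV. axis j (f x $ j)) has_derivative (\<lambda>h. \<Sum>j\<in>UNIV. axis j (D h $ j))) F"
    by (intro has_derivative_sum bounded_linear.has_derivative[OF bounded_linear_axis] assms)
  then show ?thesis
    using sum_axis by (metis (no_types, lifting) ext)
qed

subsection \<open>Holomorphic functions of several variables\<close>

text \<open>The real chain rule gives the derivative \<open>h \<mapsto> D (g' * h, h *s p')\<close>.
  Compatibility of \<open>D\<close> with multiplication by \<open>\<i>\<close> turns it into
  multiplication by one complex number.\<close>

lemma holomorphic_several_field_derivative: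
  fixes p :: "complex \<Rightarrow> complex^'n"
  assumes F: "holomorphic_several F U"
    and g: "(g has_field_derivative g') (at z)"
    and p: "\<And>j. ((\<lambda>z. p z $ j) has_field_derivative p' $ j) (at z)"
    and U: "(g z, p z) \<in> U"
  shows "(\<lambda>z. F (g z, p z)) field_differentiable (at z)"
proof -
  obtain D where D: "(F has_derivative D) (at (g z, p z))"
    and clin: "\<And>w. D (\<i> * fst w, \<i> *s snd w) = \<i> * D w"
    using F U unfolding holomorphic_several_def by blast
  interpret D: bounded_linear D
    using D by (rule has_derivative_bounded_linear)
  have "(p has_derivative (\<lambda>h. h *s p')) (at z)"
    using p by (intro has_derivative_vec_componentwise)
      (simp add: has_field_derivative_def mult.commute[of _ "_ $ _"])
  then have "((\<lambda>z. (g z, p z)) has_derivative (\<lambda>h. (g' * h, h *s p'))) (at z)"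
    using g unfolding has_field_derivative_def by (rule has_derivative_Pair[rotated])
  from diff_chain_at[OF this D]
  have deriv: "((\<lambda>z. F (g z, p z)) has_derivative (\<lambda>h. D (g' * h, h *s p'))) (at z)"
    by (simp add: o_def)
  \<comment> \<open>Split \<open>h\<close> into real and imaginary part: real linearity handles the
    first, \<open>clin\<close> the second.\<close>
  have "D (g' * h, h *s p') = D (g', p') * h" for h
  proof -
    have "(g' * h, h *s p') = Re h *\<^sub>R (g', p') + Im h *\<^sub>R (\<i> * g', \<i> *s p')"
      by (simp add: vec_eq_iff complex_eq_iff algebra_simps)
    then have "D (g' * h, h *s p') = Re h *\<^sub>R D (g', p') + Im h *\<^sub>R (\<i> * D (g', p'))"
      using clin[of "(g', p')"] by (simp only: D.add D.scaleR fst_conv snd_conv)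
    also have "\<dots> = D (g', p') * h"
      by (simp add: complex_eq_iff algebra_simps)
    finally show ?thesis .
  qed
  then have "((\<lambda>z. F (g z, p z)) has_field_derivative D (g', p')) (at z)"
    using deriv by (simp add: has_field_derivative_def)
  then show ?thesis
    by (auto simp: field_differentiable_def)
qed

lemma holomorphic_several_compose:
  fixes p :: "complex \<Rightarrow> complex^'n"
  assumes F: "holomorphic_several F U" and "open S"
    and g: "g holomorphic_on S" and p: "\<And>j. (\<lambda>z. p z $ j) holomorphic_on S"
    and U: "\<And>z. z \<in> S \<Longrightarrow> (g z, p z) \<in> U"
  shows "(\<lambda>z. F (g z, p z)) holomorphic_on S"
proof -
  have "(\<lambda>z. F (g z, p z)) field_differentiable (at z)" if "z \<in> S" for z
  proof (rule holomorphic_several_field_derivative[OF F])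
    show "(g has_field_derivative deriv g z) (at z)"
      using holomorphic_derivI[OF g \<open>open S\<close> that] .
    show "((\<lambda>z. p z $ j) has_field_derivative (\<chi> j. deriv (\<lambda>z. p z $ j) z) $ j) (at z)" for j
      using holomorphic_derivI[OF p \<open>open S\<close> that] by simp
  qed (use U that in auto)
  then show ?thesis
    using \<open>open S\<close> by (simp add: holomorphic_on_open field_differentiable_def)
qed

text \<open>Continuity bounds \<open>F\<close> near \<open>(a, b)\<close> by some \<open>B\<close>.
  On the complex line through \<open>v\<close> and \<open>w\<close>, \<open>F\<close> is holomorphic
  in one variable, so Cauchy's estimate bounds its derivative there, and the mean value inequality
  gives the Lipschitz constant.\<close>

lemma holomorphic_several_locally_Lipschitz:
  fixes a :: complex and b :: "complex^'n"
  assumes F: "holomorphic_several F U" and ab: "(a, b) \<in> U"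
  obtains R L where "R > 0" "L \<ge> 0" "ball a R \<times> ball b R \<subseteq> U"
    "\<And>z v w. \<lbrakk>z \<in> ball a R; v \<in> ball b R; w \<in> ball b R\<rbrakk>
      \<Longrightarrow> norm (F (z, v) - F (z, w)) \<le> L * norm (v - w)"
proof -
  have "open U" using F by (simp add: holomorphic_several_def)
  have "continuous (at (a, b)) F"
    using F ab has_derivative_continuous unfolding holomorphic_several_def by blast
  then obtain d where "d > 0" and d: "\<And>x. dist x (a, b) < d \<Longrightarrow> dist (F x) (F (a, b)) < 1"
    unfolding continuous_at_eps_delta by (metis zero_less_one)
  obtain e where "e > 0" and e: "ball (a, b) e \<subseteq> U"
    using \<open>open U\<close> ab by (meson open_contains_ball)
  define B where "B = norm (F (a, b)) + 1"
  \<comment> \<open>The segment from \<open>w\<close> to \<open>v\<close> is shorter than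
    \<open>2 * R\<close> and the Cauchy discs have radius \<open>R\<close>, so parameters stay below
    \<open>3 * R\<close> and points within \<open>4 * R\<close> of \<open>b\<close>. With
    \<open>norm (z - a) < R\<close> the total is below \<open>5 * R\<close>, well inside
    \<open>min d e\<close>.\<close>
  define R where "R = min d e / 8"
  have "R > 0" using \<open>d > 0\<close> \<open>e > 0\<close> by (simp add: R_def)
  have near: "dist (z, w) (a, b) < min d e" if "norm (z - a) < R" "norm (w - b) < 4 * R" for z w
  proof -
    have "dist (z, w) (a, b) \<le> norm (z - a) + norm (w - b)"
      by (simp add: dist_norm norm_prod_def sqrt_sum_squares_le_sum)
    then show ?thesis using that \<open>R > 0\<close> by (simp add: R_def)
  qed
  have bound: "norm (F (z, w)) \<le> B" if "norm (z - a) < R" "norm (w - b) < 4 * R" for z w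
  proof -
    have "norm (F (z, w) - F (a, b)) < 1"
      using d near[OF that] by (simp add: dist_norm)
    then show ?thesis
      unfolding B_def using norm_triangle_sub[of "F (z, w)" "F (a, b)"] by linarith
  qed
  have sub: "(z, w) \<in> U" if "norm (z - a) < R" "norm (w - b) < 4 * R" for z w
    using near[OF that] e by (auto simp: dist_commute)
  show thesis
  proof
    show "ball a R \<times> ball b R \<subseteq> U"
      using sub \<open>R > 0\<close> by (auto simp: dist_norm norm_minus_commute)
    show "B / R \<ge> 0" using \<open>R > 0\<close> by (simp add: B_def)
    fix z v w
    assume "z \<in> ball a R" "v \<in> ball b R" "w \<in> ball b R"
    then have z: "norm (z - a) < R" and v: "norm (v - b) < R" and w: "norm (w - b) < R"
      by (auto simp: dist_norm norm_minus_commute)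
    show "norm (F (z, v) - F (z, w)) \<le> B / R * norm (v - w)"
    proof (cases "v = w")
      case False
      define \<delta> where "\<delta> = norm (v - w)"
      have "\<delta> > 0" using False by (simp add: \<delta>_def)
      have "\<delta> < 2 * R"
        using v w norm_triangle_ineq4[of "v - b" "w - b"] by (simp add: \<delta>_def)
      \<comment> \<open>Unit speed lets Cauchy's estimate on discs of radius \<open>R\<close> bound the slope along the
        segment by \<open>B / R\<close>.\<close>
      define p where "p \<zeta> = w + (\<zeta> / \<delta>) *s (v - w)" for \<zeta> :: complex
      define g where "g \<zeta> = F (z, p \<zeta>)" for \<zeta>
      have p_near: "norm (p \<zeta> - b) \<le> norm (w - b) + norm \<zeta>" for \<zeta>
      proof -
        have "norm ((\<zeta> / \<delta>) *s (v - w)) = norm \<zeta>"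
          using \<open>\<delta> > 0\<close> unfolding norm_vector_scalar_mult_complex
          by (simp add: \<delta>_def norm_divide)
        then show ?thesis
          unfolding p_def using norm_triangle_ineq[of "w - b" "(\<zeta> / \<delta>) *s (v - w)"]
          by (simp add: algebra_simps)
      qed
      have hol: "g holomorphic_on ball 0 (3 * R)"
        unfolding g_def
      proof (rule holomorphic_several_compose[OF F open_ball])
        show "(\<lambda>\<zeta>. p \<zeta> $ j) holomorphic_on ball 0 (3 * R)" for j
          using \<open>\<delta> > 0\<close> by (auto simp: p_def intro!: holomorphic_intros)
        show "(z, p \<zeta>) \<in> U" if "\<zeta> \<in> ball 0 (3 * R)" for \<zeta>
          using that p_near[of \<zeta>] w by (intro sub z) auto
      qed auto
      have seg: "closed_segment 0 (complex_of_real \<delta>) \<subseteq> ball 0 (2 * R)"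
        using \<open>\<delta> > 0\<close> \<open>\<delta> < 2 * R\<close> by (intro closed_segment_subset) auto
      have "norm (g (complex_of_real \<delta>) - g 0) \<le> B / R * norm (complex_of_real \<delta> - 0)"
      proof (rule field_differentiable_bound[where S = "closed_segment 0 (complex_of_real \<delta>)"])
        fix \<zeta> assume "\<zeta> \<in> closed_segment 0 (complex_of_real \<delta>)"
        then have \<zeta>: "norm \<zeta> < 2 * R" using seg by auto
        then show "(g has_field_derivative deriv g \<zeta>)
            (at \<zeta> within closed_segment 0 (complex_of_real \<delta>))"
          using \<open>R > 0\<close>
          by (intro holomorphic_derivI[OF hol open_ball]) auto
        have cball: "cball \<zeta> R \<subseteq> ball 0 (3 * R)"
        proof
          fix x assume "x \<in> cball \<zeta> R"
          then have "norm (x - \<zeta>) \<le> R" by (simp add: dist_norm norm_minus_commute)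
          then show "x \<in> ball 0 (3 * R)"
            using \<zeta> norm_triangle_sub[of x \<zeta>] by simp
        qed
        have "norm ((deriv ^^ 1) g \<zeta>) \<le> fact 1 * B / R ^ 1"
        proof (rule Cauchy_inequality)
          show "g holomorphic_on ball \<zeta> R"
            using hol cball by (meson ball_subset_cball holomorphic_on_subset subset_trans)
          show "continuous_on (cball \<zeta> R) g"
            using hol cball by (meson holomorphic_on_imp_continuous_on continuous_on_subset)
          fix x assume "norm (\<zeta> - x) = R"
          then have "norm x < 3 * R"
            using cball by (auto simp: dist_norm subset_iff)
          then show "norm (g x) \<le> B"
            unfolding g_def using p_near[of x] w by (intro bound z) auto
        qed (use \<open>R > 0\<close> in auto)
        then show "norm (deriv g \<zeta>) \<le> B / R" by simp
      qed auto
      moreover have "p (complex_of_real \<delta>) = v" "p 0 = w"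
        using \<open>\<delta> > 0\<close> by (auto simp: p_def vec_eq_iff)
      ultimately show ?thesis
        using \<open>\<delta> > 0\<close> by (simp add: g_def \<delta>_def)
    qed simp
  qed (use \<open>R > 0\<close> in auto)
qed

subsection \<open>Radial growth and approximation by entire functions\<close>

text \<open>Compare with \<open>\<phi> s = C * s ^ m\<close>, for which
  \<open>s * \<phi>' s = m * \<phi> s\<close>. Passing from \<open>s *\<^sub>R v'\<close> to
  \<open>v\<close> therefore gains a factor \<open>1 / m\<close>, the source of the
  contraction.\<close>

lemma radial_growth_bound_right:
  fixes v :: "real \<Rightarrow> 'a::real_normed_vector"
  assumes "m > 0" "0 \<le> t" "t < \<rho>" "v 0 = 0"
    and v: "\<And>s. 0 \<le> s \<Longrightarrow> s < \<rho> \<Longrightarrow> (v has_vector_derivative v' s) (at s)"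
    and bd: "\<And>s. 0 < s \<Longrightarrow> s < \<rho> \<Longrightarrow> norm (s *\<^sub>R v' s) \<le> real m * C * s ^ m"
  shows "norm (v t) \<le> C * t ^ m"
proof (cases "t = 0")
  case False
  have "norm (v t - v 0) \<le> C * t ^ m - C * 0 ^ m"
  proof (rule differentiable_bound_general[where f' = v' and \<phi>' = "\<lambda>s. C * (real m * s ^ (m - 1))"])
    show "continuous_on {0..t} v"
      using assms by (intro continuous_at_imp_continuous_on ballI)
        (auto intro!: has_vector_derivative_continuous[OF v])
    show "((\<lambda>s. C * s ^ m) has_vector_derivative C * (real m * s ^ (m - 1))) (at s)" for s
      unfolding has_real_derivative_iff_has_vector_derivative[symmetric]
      by (auto intro!: derivative_eq_intros)
    fix s assume s: "0 < s" "s < t"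
    have "s * norm (v' s) \<le> s * (C * (real m * s ^ (m - 1)))"
      using bd[of s] s assms(1,3) by (cases m) (auto simp: mult_ac)
    then show "norm (v' s) \<le> C * (real m * s ^ (m - 1))"
      using s by simp
  qed (use False assms in \<open>auto intro!: continuous_intros\<close>)
  then show ?thesis using assms by (simp add: zero_power)
qed (use assms in \<open>simp add: zero_power\<close>)

lemma radial_growth_bound:
  fixes v :: "real \<Rightarrow> 'a::real_normed_vector"
  assumes "m > 0" "\<bar>t\<bar> < \<rho>" "v 0 = 0"
    and v: "\<And>s. \<bar>s\<bar> < \<rho> \<Longrightarrow> (v has_vector_derivative v' s) (at s)"
    and bd: "\<And>s. \<bar>s\<bar> < \<rho> \<Longrightarrow> norm (s *\<^sub>R v' s) \<le> real m * C * \<bar>s\<bar> ^ m"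
  shows "norm (v t) \<le> C * \<bar>t\<bar> ^ m"
proof (cases "t \<ge> 0")
  case True
  have "norm (v t) \<le> C * t ^ m"
  proof (rule radial_growth_bound_right)
    show "norm (s *\<^sub>R v' s) \<le> real m * C * s ^ m" if "0 < s" "s < \<rho>" for s
      using bd[of s] that by simp
  qed (use True assms in auto)
  then show ?thesis using True by simp
next
  case False
  \<comment> \<open>Reflection \<open>s \<mapsto> - s\<close> reduces negative times to positive
    ones; the double negation exhibits the reflected function at \<open>- t\<close>.\<close>
  have "norm (v (- (- t))) \<le> C * (- t) ^ m"
  proof (rule radial_growth_bound_right[where v = "\<lambda>s. v (- s)" and v' = "\<lambda>s. - v' (- s)"])
    show "((\<lambda>s. v (- s)) has_vector_derivative - v' (- s)) (at s)" if "0 \<le> s" "s < \<rho>" for s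
    proof -
      have "((\<lambda>s. - s) has_vector_derivative - 1) (at s)"
        by (auto intro!: derivative_eq_intros)
      moreover have "(v has_vector_derivative v' (- s)) (at (- s))"
        using that by (intro v) auto
      ultimately show ?thesis
        using vector_diff_chain_at[of uminus "-1" s v "v' (- s)"] by (simp add: o_def)
    qed
    show "norm (s *\<^sub>R - v' (- s)) \<le> real m * C * s ^ m" if "0 < s" "s < \<rho>" for s
      using bd[of "- s"] that by simp
  qed (use False assms in auto)
  then show ?thesis using False by simp
qed

text \<open>On the ray through \<open>z\<close> with unit direction \<open>u\<close>, the operator z
  d/dz restricts to s d/ds, so the real estimate applies to \<open>s \<mapsto> w (s * u)\<close> at
  \<open>s = norm z\<close>.\<close>

lemma complex_radial_growth_bound:
  fixes w :: "complex \<Rightarrow> complex^'n"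
  assumes "m > 0" "norm z < \<rho>" "w 0 = 0"
    and w: "\<And>z j. norm z < \<rho> \<Longrightarrow> ((\<lambda>z. w z $ j) has_field_derivative w' z $ j) (at z)"
    and bd: "\<And>z. norm z < \<rho> \<Longrightarrow> norm (z *s w' z) \<le> real m * C * norm z ^ m"
  shows "norm (w z) \<le> C * norm z ^ m"
proof (cases "z = 0")
  case False
  define u where "u = sgn z"
  have u: "norm u = 1" "complex_of_real (norm z) * u = z"
    using False by (simp_all add: u_def norm_sgn) (simp add: sgn_eq)
  have "norm (w (complex_of_real (norm z) * u)) \<le> C * \<bar>norm z\<bar> ^ m"
  proof (rule radial_growth_bound[where v = "\<lambda>s. w (of_real s * u)"
        and v' = "\<lambda>s. u *s w' (of_real s * u)"])
    fix s :: real assume s: "\<bar>s\<bar> < \<rho>"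
    then have su: "norm (of_real s * u) < \<rho>" by (simp add: norm_mult u)
    have "((\<lambda>s. w (of_real s * u) $ j) has_vector_derivative u * (w' (of_real s * u) $ j)) (at s)" for j
    proof -
      have "((\<lambda>s. of_real s * u) has_vector_derivative u) (at s)"
        by (auto intro!: derivative_eq_intros simp: has_vector_derivative_def scaleR_conv_of_real)
      from field_vector_diff_chain_at[OF this w[OF su]] show ?thesis by (simp add: o_def)
    qed
    then show "((\<lambda>s. w (of_real s * u)) has_vector_derivative u *s w' (of_real s * u)) (at s)"
      unfolding has_vector_derivative_def
      by (intro has_derivative_vec_componentwise) simp
    have "norm (s *\<^sub>R (u *s w' (of_real s * u))) = norm ((of_real s * u) *s w' (of_real s * u))"
      by (simp add: norm_vector_scalar_mult_complex norm_mult)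
    also have "\<dots> \<le> real m * C * \<bar>s\<bar> ^ m"
      using bd[OF su] by (simp add: norm_mult u)
    finally show "norm (s *\<^sub>R (u *s w' (of_real s * u))) \<le> real m * C * \<bar>s\<bar> ^ m" .
  qed (use assms in auto)
  then show ?thesis by (simp add: u)
qed (use assms in \<open>simp add: zero_power\<close>)

section \<open>Restriction to the real axis and continuity of holomorphic maps\<close>

lemma has_vector_derivative_of_real_compose_vec:
  fixes p :: "complex \<Rightarrow> complex^'n"
  assumes "\<And>j. ((\<lambda>z. p z $ j) has_field_derivative p' $ j) (at (of_real t))"
  shows "((\<lambda>s. p (of_real s)) has_vector_derivative p') (at t)"
proof -
  have "((\<lambda>s. p (of_real s) $ j) has_vector_derivative p' $ j) (at t)" for j
  proof -
    have "(complex_of_real has_vector_derivative 1) (at t)"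
      by (auto intro!: derivative_eq_intros simp: has_vector_derivative_def scaleR_conv_of_real)
    from field_vector_diff_chain_at[OF this assms[of j]] show ?thesis by (simp add: o_def)
  qed
  then show ?thesis
    unfolding has_vector_derivative_def
    by (intro has_derivative_vec_componentwise) simp
qed

lemma isCont_vec_holomorphic:
  fixes p :: "complex \<Rightarrow> complex^'n"
  assumes "\<And>j. ((\<lambda>z. p z $ j) has_field_derivative p' $ j) (at z)"
  shows "isCont p z"
  using assms unfolding isCont_def
  by (intro vec_tendstoI) (metis DERIV_isCont isCont_def)

section \<open>Entire approximation of smooth functions\<close>

lemma iter_vderiv_vector_derivative:
  "iter_vderiv k (\<lambda>t. vector_derivative g (at t)) = iter_vderiv (Suc k) g"
  by (induction k) auto

lemma smooth_on_vector_derivative: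
  "smooth_on S g \<Longrightarrow> smooth_on S (\<lambda>t. vector_derivative g (at t))"
  unfolding smooth_on_def iter_vderiv_vector_derivative by blast

lemma smooth_on_has_vector_derivative:
  assumes "smooth_on S g" "t \<in> S"
  shows "(g has_vector_derivative vector_derivative g (at t)) (at t)"
proof -
  have "iter_vderiv 0 g differentiable (at t)"
    using assms unfolding smooth_on_def by blast
  then show ?thesis
    by (simp add: vector_derivative_works)
qed

text \<open>Integrating an approximation of \<open>g'\<close> raises its order by one. The
  approximant \<open>p\<close> comes with its derivative \<open>q\<close>, so that \<open>g\<close>
  and \<open>g'\<close> are approximated simultaneously.\<close>

lemma primitive_approximation:
  fixes g :: "real \<Rightarrow> complex^'n"
  assumes g: "\<And>t. \<bar>t\<bar> < \<rho> \<Longrightarrow> (g has_vector_derivative g' t) (at t)"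
    and q: "\<And>j. (\<lambda>z. q z $ j) holomorphic_on UNIV"
    and bd: "\<And>t. \<bar>t\<bar> < \<rho> \<Longrightarrow> norm (g' t - q (of_real t)) \<le> C * \<bar>t\<bar> ^ m"
  obtains p where "\<And>z j. ((\<lambda>z. p z $ j) has_field_derivative q z $ j) (at z)" "p 0 = g 0"
    "\<And>t. \<bar>t\<bar> < \<rho> \<Longrightarrow> norm (g t - p (of_real t)) \<le> C / real (Suc m) * \<bar>t\<bar> ^ Suc m"
proof -
  have "\<exists>P. \<forall>z. (P has_field_derivative q z $ j) (at z)" for j
    using holomorphic_convex_primitive'[OF convex_UNIV open_UNIV q[of j]] by auto
  then obtain P where P: "\<And>j z. (P j has_field_derivative q z $ j) (at z)"
    by metis
  define p where "p z = (\<chi> j. P j z - P j 0 + g 0 $ j)" for z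
  have p: "((\<lambda>z. p z $ j) has_field_derivative q z $ j) (at z)" for z j
    by (auto simp: p_def intro!: derivative_eq_intros P)
  have p0: "p 0 = g 0" by (simp add: p_def vec_eq_iff)
  have "norm (g t - p (of_real t)) \<le> C / real (Suc m) * \<bar>t\<bar> ^ Suc m" if "\<bar>t\<bar> < \<rho>" for t
  proof (rule radial_growth_bound[where v = "\<lambda>t. g t - p (of_real t)"
        and v' = "\<lambda>t. g' t - q (of_real t)", OF _ that])
    fix s assume s: "\<bar>s\<bar> < \<rho>"
    show "((\<lambda>t. g t - p (of_real t)) has_vector_derivative g' s - q (of_real s)) (at s)"
      by (intro has_vector_derivative_diff g s has_vector_derivative_of_real_compose_vec p)
    have "norm (s *\<^sub>R (g' s - q (of_real s))) \<le> \<bar>s\<bar> * (C * \<bar>s\<bar> ^ m)"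
      using bd[OF s] by (simp add: mult_left_mono)
    then show "norm (s *\<^sub>R (g' s - q (of_real s))) \<le> real (Suc m) * (C / real (Suc m)) * \<bar>s\<bar> ^ Suc m"
      by (simp add: mult_ac)
  qed (simp_all add: p0)
  with p p0 show thesis by (rule that)
qed

text \<open>A form of Taylor's theorem obtained by integration. Order 0 is boundedness of
  \<open>g\<close> on the compact \<open>cball 0 \<rho>\<close>, whence \<open>\<rho> < r\<close>;
  each further order approximates the derivative and takes a primitive.\<close>

lemma smooth_on_entire_approximation:
  fixes g :: "real \<Rightarrow> complex^'n"
  assumes "smooth_on (ball 0 r) g" "\<rho> < r"
  shows "\<exists>p C. (\<forall>j. (\<lambda>z. p z $ j) holomorphic_on UNIV) \<and>
    (\<forall>t. \<bar>t\<bar> < \<rho> \<longrightarrow> norm (g t - p (of_real t)) \<le> C * \<bar>t\<bar> ^ m)"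
  using assms(1)
proof (induction m arbitrary: g)
  case 0
  have "continuous_on (cball 0 \<rho>) g"
  proof (intro continuous_at_imp_continuous_on ballI)
    fix t :: real assume "t \<in> cball 0 \<rho>"
    then show "isCont g t"
      using assms(2) by (intro has_vector_derivative_continuous[OF smooth_on_has_vector_derivative[OF 0]]) auto
  qed
  then have "bounded (g ` cball 0 \<rho>)"
    by (intro compact_imp_bounded compact_continuous_image) auto
  then obtain C where "\<And>t. t \<in> cball 0 \<rho> \<Longrightarrow> norm (g t) \<le> C"
    unfolding bounded_iff by (metis imageI)
  then show ?case
    by (intro exI[of _ "\<lambda>_. 0"] exI[of _ C]) auto
next
  case (Suc m)
  obtain q C where "\<And>j. (\<lambda>z. q z $ j) holomorphic_on UNIV"
    and "\<And>t. \<bar>t\<bar> < \<rho> \<Longrightarrow> norm (vector_derivative g (at t) - q (of_real t)) \<le> C * \<bar>t\<bar> ^ m"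
    using Suc.IH[OF smooth_on_vector_derivative[OF Suc.prems]] by blast
  moreover have "(g has_vector_derivative vector_derivative g (at t)) (at t)" if "\<bar>t\<bar> < \<rho>" for t
    using that assms(2) by (intro smooth_on_has_vector_derivative[OF Suc.prems]) simp
  ultimately obtain p where p: "\<And>z j. ((\<lambda>z. p z $ j) has_field_derivative q z $ j) (at z)"
    and bd: "\<And>t. \<bar>t\<bar> < \<rho> \<Longrightarrow> norm (g t - p (of_real t)) \<le> C / real (Suc m) * \<bar>t\<bar> ^ Suc m"
    using primitive_approximation[of \<rho> g "\<lambda>t. vector_derivative g (at t)" q C m] by metis
  have "(\<lambda>z. p z $ j) holomorphic_on UNIV" for j
    using p by (auto simp: holomorphic_on_open)
  with bd show ?case by blast
qed

text \<open>Smallness along the positive real axis alone forces a zero of order \<open>m\<close>: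
  the bound gives \<open>q 0 = 0\<close> by continuity, and the quotient by \<open>z\<close>,
  holomorphic across 0, satisfies the bound with exponent one lower.\<close>

lemma holomorphic_factor_power:
  assumes "q holomorphic_on ball 0 \<rho>" "\<rho> > 0"
    and "\<And>t. 0 < t \<Longrightarrow> t < \<rho> \<Longrightarrow> norm (q (of_real t)) \<le> C * t ^ m"
  shows "\<exists>h. h holomorphic_on ball 0 \<rho> \<and> (\<forall>z\<in>ball 0 \<rho>. q z = z ^ m * h z)"
  using assms
proof (induction m arbitrary: q)
  case 0
  then show ?case by auto
next
  case (Suc m)
  have "q 0 = 0"
  proof -
    have "isCont q 0"
      using Suc.prems by (intro continuous_on_interior[of "ball 0 \<rho>"])
        (auto simp: holomorphic_on_imp_continuous_on interior_open)
    then have "((\<lambda>t. q (complex_of_real t)) \<longlongrightarrow> q 0) (at_right 0)"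
      by (intro isCont_tendsto_compose[of 0 q]) (auto intro!: tendsto_eq_intros)
    moreover have "((\<lambda>t. q (complex_of_real t)) \<longlongrightarrow> 0) (at_right 0)"
    proof (rule Lim_null_comparison)
      show "\<forall>\<^sub>F t in at_right 0. norm (q (complex_of_real t)) \<le> C * t ^ Suc m"
        using Suc.prems by (auto simp: eventually_at_right intro!: exI[of _ \<rho>])
      show "((\<lambda>t. C * t ^ Suc m) \<longlongrightarrow> 0) (at_right 0)"
        by (auto intro!: tendsto_eq_intros)
    qed
    ultimately show ?thesis
      using tendsto_unique trivial_limit_at_right_real by blast
  qed
  \<comment> \<open>The value \<open>deriv q 0\<close> removes the singularity at 0; the
    unsimplified quotient matches \<open>pole_lemma_open\<close>.\<close>
  define g where "g z = (if z = 0 then deriv q 0 else (q z - q 0) / (z - 0))" for z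
  have g: "g holomorphic_on ball 0 \<rho>"
    using pole_lemma_open[OF Suc.prems(1) open_ball, of 0] unfolding g_def .
  have q_eq: "q z = z * g z" for z
    using \<open>q 0 = 0\<close> by (simp add: g_def)
  have "norm (g (of_real t)) \<le> C * t ^ m" if "0 < t" "t < \<rho>" for t
    using Suc.prems(3)[OF that] that by (simp add: q_eq norm_mult)
  from Suc.IH[OF g Suc.prems(2) this] obtain h
    where "h holomorphic_on ball 0 \<rho>" "\<forall>z\<in>ball 0 \<rho>. g z = z ^ m * h z"
    by blast
  then show ?case
    using q_eq by (auto intro!: exI[of _ h])
qed

text \<open>Inverts z d/dz with free initial value \<open>c\<close>: since \<open>h 0 = 0\<close>,
  the quotient \<open>h z / z\<close> extends holomorphically over 0 and has a primitive on the
  disc.\<close>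

lemma holomorphic_log_primitive:
  assumes "h holomorphic_on ball 0 \<rho>" "h 0 = 0"
  obtains W W' where "W 0 = c" "\<And>z. z \<in> ball 0 \<rho> \<Longrightarrow> (W has_field_derivative W' z) (at z)"
    "\<And>z. z * W' z = h z"
proof -
  define W' where "W' z = (if z = 0 then deriv h 0 else (h z - h 0) / (z - 0))" for z
  have "W' holomorphic_on ball 0 \<rho>"
    using pole_lemma_open[OF assms(1) open_ball, of 0] unfolding W'_def .
  from holomorphic_convex_primitive'[OF convex_ball open_ball this] obtain V
    where V: "\<And>z. z \<in> ball 0 \<rho> \<Longrightarrow> (V has_field_derivative W' z) (at z within ball 0 \<rho>)"
    by blast
  show thesis
  proof (rule that[of "\<lambda>z. V z - V 0 + c" W'])
    show "((\<lambda>z. V z - V 0 + c) has_field_derivative W' z) (at z)" if "z \<in> ball 0 \<rho>" for z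
      using V[OF that] unfolding at_within_open[OF that open_ball]
      by (auto intro!: derivative_eq_intros)
    show "z * W' z = h z" for z
      using assms(2) by (simp add: W'_def)
  qed simp
qed

subsection \<open>Picard iteration in a weighted norm\<close>

text \<open>\<open>p\<close> is an approximate solution with derivative \<open>p'\<close>. The
  factor \<open>real m\<close> in the residual bound cancels on integration, so the first correction
  is at most \<open>A * norm z ^ m\<close>. Later corrections halve, so all iterates stay within
  twice that of \<open>p\<close>; \<open>tube\<close> keeps this neighbourhood where
  \<open>F\<close> is Lipschitz.\<close>

locale briot_bouquet_approximation =
  fixes F :: "complex \<Rightarrow> complex^'n \<Rightarrow> complex^'n"
    and U :: "(complex \<times> (complex^'n)) set"
    and p p' :: "complex \<Rightarrow> complex^'n"
    and m :: nat and \<rho> R L A :: real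
  assumes F: "\<And>j. holomorphic_several (\<lambda>(z, w). F z w $ j) U"
    and U: "ball 0 \<rho> \<times> ball 0 R \<subseteq> U"
    and p: "\<And>z j. z \<in> ball 0 \<rho> \<Longrightarrow> ((\<lambda>z. p z $ j) has_field_derivative p' z $ j) (at z)"
    and Lip: "\<And>z v w. \<lbrakk>z \<in> ball 0 \<rho>; v \<in> ball 0 R; w \<in> ball 0 R\<rbrakk>
      \<Longrightarrow> norm (F z v - F z w) \<le> L * norm (v - w)"
    and m: "m > 0" "2 * L \<le> real m" and nonneg: "L \<ge> 0" "A \<ge> 0"
    and tube: "\<And>z. z \<in> ball 0 \<rho> \<Longrightarrow> norm (p z) + 2 * A * norm z ^ m < R"
    and residual: "\<And>z. z \<in> ball 0 \<rho> \<Longrightarrow> norm (F z (p z) - z *s p' z) \<le> real m * A * norm z ^ m"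
begin

text \<open>The set left invariant by the iteration: a ball of radius \<open>2 * A\<close> about
  \<open>p\<close> in the norm weighted by \<open>norm z ^ m\<close>.\<close>

definition admissible :: "(complex \<Rightarrow> complex^'n) \<Rightarrow> bool" where
  "admissible W \<longleftrightarrow> (\<forall>j. (\<lambda>z. W z $ j) holomorphic_on ball 0 \<rho>) \<and>
     (\<forall>z\<in>ball 0 \<rho>. norm (W z - p z) \<le> 2 * A * norm z ^ m)"

text \<open>A relation, because the constant of integration is left open. Admissibility of
  \<open>V\<close> fixes it: the weight vanishes at 0, so \<open>V 0 = p 0\<close>.\<close>

definition picard_step :: "(complex \<Rightarrow> complex^'n) \<Rightarrow> (complex \<Rightarrow> complex^'n) \<Rightarrow> bool" where
  "picard_step W V \<longleftrightarrow> (\<exists>V'. \<forall>z\<in>ball 0 \<rho>.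
     (\<forall>j. ((\<lambda>z. V z $ j) has_field_derivative V' z $ j) (at z)) \<and> z *s V' z = F z (W z))"

lemma picard_stepE:
  assumes "picard_step W V"
  obtains V' where "\<And>z j. z \<in> ball 0 \<rho> \<Longrightarrow> ((\<lambda>z. V z $ j) has_field_derivative V' z $ j) (at z)"
    "\<And>z. z \<in> ball 0 \<rho> \<Longrightarrow> z *s V' z = F z (W z)"
  using assms unfolding picard_step_def by blast

lemma p_holomorphic: "(\<lambda>z. p z $ j) holomorphic_on ball 0 \<rho>"
  using p holomorphic_on_open[OF open_ball] by blast

lemma p_in_ball: "z \<in> ball 0 \<rho> \<Longrightarrow> p z \<in> ball 0 R"
proof -
  assume "z \<in> ball 0 \<rho>"
  moreover have "0 \<le> 2 * A * norm z ^ m" using nonneg by simp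
  ultimately show ?thesis using tube[of z] by simp
qed

lemma admissible_in_ball:
  assumes "admissible W" "z \<in> ball 0 \<rho>"
  shows "W z \<in> ball 0 R"
proof -
  have "norm (W z) \<le> norm (p z) + norm (W z - p z)" by (rule norm_triangle_sub)
  also have "norm (W z - p z) \<le> 2 * A * norm z ^ m"
    using assms by (auto simp: admissible_def)
  finally show ?thesis using tube[OF assms(2)] by simp
qed

lemma admissible_zero:
  assumes "admissible W" "\<rho> > 0"
  shows "W 0 = p 0"
proof -
  have "norm (W 0 - p 0) \<le> 2 * A * norm (0 :: complex) ^ m"
    using assms unfolding admissible_def by (metis centre_in_ball)
  then show ?thesis using m(1) by (simp add: zero_power)
qed

lemma admissible_p: "admissible p"
  using nonneg by (auto simp: admissible_def p_holomorphic)

text \<open>Uses \<open>L \<le> real m / 2\<close>. The factor \<open>real m\<close> is kept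
  explicit because the radial growth bounds cancel it, leaving the constant
  \<open>D / 2\<close>.\<close>

lemma half_contraction:
  assumes "z \<in> ball 0 \<rho>" "v \<in> ball 0 R" "w \<in> ball 0 R" "norm (v - w) \<le> D * B" "B \<ge> 0" "D \<ge> 0"
  shows "norm (F z v - F z w) \<le> real m * (D / 2) * B"
proof -
  have "norm (F z v - F z w) \<le> L * norm (v - w)" using assms by (intro Lip)
  also have "\<dots> \<le> (real m / 2) * (D * B)"
    using assms m nonneg by (intro mult_mono) auto
  finally show ?thesis by simp
qed

lemma picard_step_exists:
  assumes W: "admissible W" and "\<rho> > 0"
  shows "\<exists>V. admissible V \<and> picard_step W V"
proof -
  \<comment> \<open>The residual bound vanishes at 0. This is the solvability condition for z V' = F
    z (W z), since every admissible \<open>W\<close> has \<open>W 0 = p 0\<close>.\<close>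
  have "F 0 (p 0) = 0"
    using residual[of 0] m(1) \<open>\<rho> > 0\<close> by (simp add: zero_power)
  have hol: "(\<lambda>z. F z (W z) $ j) holomorphic_on ball 0 \<rho>" for j
  proof -
    have "(\<lambda>z. (\<lambda>(z, w). F z w $ j) (z, W z)) holomorphic_on ball 0 \<rho>"
    proof (rule holomorphic_several_compose[OF F open_ball])
      show "(z, W z) \<in> U" if "z \<in> ball 0 \<rho>" for z
        using admissible_in_ball[OF W that] that U by blast
    qed (use W in \<open>auto simp: admissible_def\<close>)
    then show ?thesis by simp
  qed
  have "\<exists>V V'. V 0 = p 0 $ j \<and> (\<forall>z\<in>ball 0 \<rho>. (V has_field_derivative V' z) (at z)) \<and>
      (\<forall>z. z * V' z = F z (W z) $ j)" for j
  proof -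
    have "F 0 (W 0) $ j = 0"
      using admissible_zero[OF assms] \<open>F 0 (p 0) = 0\<close> by simp
    from holomorphic_log_primitive[OF hol this, of "p 0 $ j"] show ?thesis by metis
  qed
  then obtain V V' where V0: "\<And>j. V j 0 = p 0 $ j"
    and dV: "\<And>j z. z \<in> ball 0 \<rho> \<Longrightarrow> (V j has_field_derivative V' j z) (at z)"
    and V': "\<And>j z. z * V' j z = F z (W z) $ j"
    by metis
  define X where "X z = (\<chi> j. V j z)" for z
  define X' where "X' z = (\<chi> j. V' j z)" for z
  have X: "((\<lambda>z. X z $ j) has_field_derivative X' z $ j) (at z)" if "z \<in> ball 0 \<rho>" for j z
    using dV[OF that] by (simp add: X_def X'_def)
  have X': "z *s X' z = F z (W z)" for z
    using V' by (simp add: X'_def vec_eq_iff)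
  have "norm (X z - p z) \<le> 2 * A * norm z ^ m" if "z \<in> ball 0 \<rho>" for z
  proof (rule complex_radial_growth_bound[where w = "\<lambda>z. X z - p z" and w' = "\<lambda>z. X' z - p' z"])
    fix \<zeta> :: complex assume "norm \<zeta> < \<rho>"
    then have \<zeta>: "\<zeta> \<in> ball 0 \<rho>" by simp
    show "((\<lambda>z. (X z - p z) $ j) has_field_derivative (X' \<zeta> - p' \<zeta>) $ j) (at \<zeta>)" for j
      using X[OF \<zeta>, of j] p[OF \<zeta>, of j] by (auto intro!: derivative_eq_intros)
    \<comment> \<open>The contraction halves \<open>2 * A\<close> to \<open>A\<close> and the
      residual contributes another \<open>A\<close>, which reproduces the radius
      \<open>2 * A\<close>.\<close>
    have "norm (F \<zeta> (W \<zeta>) - F \<zeta> (p \<zeta>)) \<le> real m * (2 * A / 2) * norm \<zeta> ^ m"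
      using W \<zeta> nonneg
      by (intro half_contraction admissible_in_ball p_in_ball) (auto simp: admissible_def)
    moreover have "\<zeta> *s (X' \<zeta> - p' \<zeta>) = (F \<zeta> (W \<zeta>) - F \<zeta> (p \<zeta>)) + (F \<zeta> (p \<zeta>) - \<zeta> *s p' \<zeta>)"
      by (simp add: vector_sub_rdistrib vector_ssub_ldistrib X')
    ultimately show "norm (\<zeta> *s (X' \<zeta> - p' \<zeta>)) \<le> real m * (2 * A) * norm \<zeta> ^ m"
      using residual[OF \<zeta>] norm_triangle_ineq[of "F \<zeta> (W \<zeta>) - F \<zeta> (p \<zeta>)" "F \<zeta> (p \<zeta>) - \<zeta> *s p' \<zeta>"]
      by (simp add: algebra_simps)
  qed (use that m V0 in \<open>auto simp: X_def vec_eq_iff\<close>)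
  moreover have "(\<lambda>z. X z $ j) holomorphic_on ball 0 \<rho>" for j
    using X holomorphic_on_open[OF open_ball] by blast
  ultimately show ?thesis
    using X X' unfolding admissible_def picard_step_def by blast
qed

section \<open>The sequence of iterates and its limit\<close>

lemma picard_sequence_exists:
  assumes "\<rho> > 0"
  obtains W where "W 0 = p" "\<And>n. admissible (W n)" "\<And>n. picard_step (W n) (W (Suc n))"
proof -
  \<comment> \<open>The clause for \<open>n = 0\<close> makes dependent choice start at
    \<open>p\<close>.\<close>
  have "\<exists>W. \<forall>n. (admissible (W n) \<and> (n = 0 \<longrightarrow> W n = p)) \<and> picard_step (W n) (W (Suc n))"
    by (rule dependent_nat_choice) (use admissible_p picard_step_exists assms in auto)
  then show thesis using that by blast
qed

text \<open>The residual of \<open>p\<close> controls the first difference; afterwards each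
  difference inherits half the previous constant through \<open>half_contraction\<close> and radial
  growth.\<close>

lemma picard_step_diff:
  assumes W: "W 0 = p" "\<And>n. admissible (W n)" "\<And>n. picard_step (W n) (W (Suc n))"
    and z: "z \<in> ball 0 \<rho>"
  shows "norm (W (Suc n) z - W n z) \<le> A * (1 / 2) ^ n * norm z ^ m"
  using z
proof (induction n arbitrary: z)
  case (0 z)
  obtain V' where V': "\<And>z j. z \<in> ball 0 \<rho> \<Longrightarrow>
      ((\<lambda>z. W (Suc 0) z $ j) has_field_derivative V' z $ j) (at z)"
    "\<And>z. z \<in> ball 0 \<rho> \<Longrightarrow> z *s V' z = F z (p z)"
    using picard_stepE[OF W(3)[of 0]] unfolding W(1) by blast
  have "norm (W (Suc 0) z - p z) \<le> A * norm z ^ m"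
  proof (rule complex_radial_growth_bound[where w = "\<lambda>z. W (Suc 0) z - p z"
        and w' = "\<lambda>z. V' z - p' z" and \<rho> = \<rho>])
    show "W (Suc 0) 0 - p 0 = 0"
      using admissible_zero[OF W(2)] 0 by (simp add: le_less_trans[OF norm_ge_zero])
    fix \<zeta> :: complex assume "norm \<zeta> < \<rho>"
    then have \<zeta>: "\<zeta> \<in> ball 0 \<rho>" by simp
    show "((\<lambda>z. (W (Suc 0) z - p z) $ j) has_field_derivative (V' \<zeta> - p' \<zeta>) $ j) (at \<zeta>)" for j
      using V'(1)[OF \<zeta>, of j] p[OF \<zeta>, of j] by (auto intro!: derivative_eq_intros)
    show "norm (\<zeta> *s (V' \<zeta> - p' \<zeta>)) \<le> real m * A * norm \<zeta> ^ m"
      using residual[OF \<zeta>] by (simp add: vector_ssub_ldistrib V'(2)[OF \<zeta>])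
  qed (use 0 m in auto)
  then show ?case by (simp add: W(1))
next
  case (Suc n z)
  obtain V' where V': "\<And>z j. z \<in> ball 0 \<rho> \<Longrightarrow>
      ((\<lambda>z. W (Suc n) z $ j) has_field_derivative V' z $ j) (at z)"
    "\<And>z. z \<in> ball 0 \<rho> \<Longrightarrow> z *s V' z = F z (W n z)"
    using picard_stepE[OF W(3)[of n]] by blast
  obtain X' where X': "\<And>z j. z \<in> ball 0 \<rho> \<Longrightarrow>
      ((\<lambda>z. W (Suc (Suc n)) z $ j) has_field_derivative X' z $ j) (at z)"
    "\<And>z. z \<in> ball 0 \<rho> \<Longrightarrow> z *s X' z = F z (W (Suc n) z)"
    using picard_stepE[OF W(3)[of "Suc n"]] by blast
  show ?case
  proof (rule complex_radial_growth_bound[where w = "\<lambda>z. W (Suc (Suc n)) z - W (Suc n) z"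
        and w' = "\<lambda>z. X' z - V' z" and \<rho> = \<rho>])
    show "W (Suc (Suc n)) 0 - W (Suc n) 0 = 0"
      using admissible_zero[OF W(2)] Suc.prems by (simp add: le_less_trans[OF norm_ge_zero])
    fix \<zeta> :: complex assume "norm \<zeta> < \<rho>"
    then have \<zeta>: "\<zeta> \<in> ball 0 \<rho>" by simp
    show "((\<lambda>z. (W (Suc (Suc n)) z - W (Suc n) z) $ j) has_field_derivative (X' \<zeta> - V' \<zeta>) $ j) (at \<zeta>)" for j
      using V'(1)[OF \<zeta>, of j] X'(1)[OF \<zeta>, of j] by (auto intro!: derivative_eq_intros)
    have "norm (F \<zeta> (W (Suc n) \<zeta>) - F \<zeta> (W n \<zeta>)) \<le> real m * (A * (1 / 2) ^ n / 2) * norm \<zeta> ^ m"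
      using Suc.IH[OF \<zeta>] \<zeta> nonneg
      by (intro half_contraction admissible_in_ball W(2)) auto
    then show "norm (\<zeta> *s (X' \<zeta> - V' \<zeta>)) \<le> real m * (A * (1 / 2) ^ Suc n) * norm \<zeta> ^ m"
      by (simp add: vector_ssub_ldistrib V'(2)[OF \<zeta>] X'(2)[OF \<zeta>])
  qed (use Suc.prems m in auto)
qed

lemma picard_limit:
  assumes W: "W 0 = p" "\<And>n. admissible (W n)" "\<And>n. picard_step (W n) (W (Suc n))"
  obtains G where "\<And>j. (\<lambda>z. G z $ j) holomorphic_on ball 0 \<rho>"
    "\<And>z. z \<in> ball 0 \<rho> \<Longrightarrow> (\<lambda>n. W n z) \<longlonglongrightarrow> G z"
proof -
  \<comment> \<open>The limit as a telescoping series over the initial term \<open>p\<close>, so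
    that the M-test applies componentwise.\<close>
  define G where "G z = (\<chi> j. (\<Sum>n. (W (Suc n) z - W n z) $ j) + p z $ j)" for z
  have unif: "uniform_limit (ball 0 \<rho>) (\<lambda>n z. W n z $ j) (\<lambda>z. G z $ j) sequentially" for j
  proof -
    \<comment> \<open>Bounding the weight by \<open>\<rho> ^ m\<close> makes the geometric majorant
      independent of \<open>z\<close>.\<close>
    have "norm ((W (Suc n) z - W n z) $ j) \<le> A * \<rho> ^ m * (1 / 2) ^ n" if "z \<in> ball 0 \<rho>" for n z
    proof -
      have "norm ((W (Suc n) z - W n z) $ j) \<le> norm (W (Suc n) z - W n z)"
        by (rule Finite_Cartesian_Product.norm_nth_le)
      also have "\<dots> \<le> A * (1 / 2) ^ n * norm z ^ m"
        by (rule picard_step_diff[OF W that])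
      also have "\<dots> \<le> A * (1 / 2) ^ n * \<rho> ^ m"
        using that nonneg by (intro mult_left_mono power_mono) auto
      finally show ?thesis by (simp add: mult_ac)
    qed
    then have "uniform_limit (ball 0 \<rho>) (\<lambda>n z. \<Sum>i<n. (W (Suc i) z - W i z) $ j)
        (\<lambda>z. \<Sum>i. (W (Suc i) z - W i z) $ j) sequentially"
      by (rule Weierstrass_m_test) (auto intro!: summable_mult summable_geometric)
    then have "uniform_limit (ball 0 \<rho>) (\<lambda>n z. (\<Sum>i<n. (W (Suc i) z - W i z) $ j) + p z $ j)
        (\<lambda>z. G z $ j) sequentially"
      unfolding G_def by (simp, intro uniform_limit_add uniform_limit_const)
    moreover have "(\<Sum>i<n. (W (Suc i) z - W i z) $ j) + p z $ j = W n z $ j" for n z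
      using sum_lessThan_telescope[of "\<lambda>i. W i z $ j" n] by (simp add: W(1))
    ultimately show ?thesis by simp
  qed
  show thesis
  proof
    fix j
    show "(\<lambda>z. G z $ j) holomorphic_on ball 0 \<rho>"
    proof (rule holomorphic_uniform_sequence[OF open_ball])
      show "(\<lambda>z. W n z $ j) holomorphic_on ball 0 \<rho>" for n
        using W(2) by (simp add: admissible_def)
      fix z :: complex assume "z \<in> ball 0 \<rho>"
      then obtain d where "d > 0" "cball z d \<subseteq> ball 0 \<rho>"
        using open_contains_cball open_ball by meson
      then show "\<exists>d. 0 < d \<and> cball z d \<subseteq> ball 0 \<rho> \<and>
          uniform_limit (cball z d) (\<lambda>n z. W n z $ j) (\<lambda>z. G z $ j) sequentially"
        using uniform_limit_on_subset[OF unif] by blast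
    qed
  next
    fix z :: complex assume "z \<in> ball 0 \<rho>"
    then show "(\<lambda>n. W n z) \<longlonglongrightarrow> G z"
      by (intro vec_tendstoI tendsto_uniform_limitI[OF unif])
  qed
qed

text \<open>Identifies the limit on the real axis. The solution \<open>y\<close> is a fixed point of
  the iteration there, so its distance to \<open>W n\<close> halves at each step, starting from its
  own constant \<open>D\<close>; \<open>yR\<close> puts \<open>y\<close> where the Lipschitz bound
  holds.\<close>

lemma picard_real_bound:
  assumes W: "W 0 = p" "\<And>n. admissible (W n)" "\<And>n. picard_step (W n) (W (Suc n))"
    and y: "\<And>t. \<bar>t\<bar> < \<rho> \<Longrightarrow> (y has_vector_derivative y' t) (at t)"
    and ode: "\<And>t. \<bar>t\<bar> < \<rho> \<Longrightarrow> t *\<^sub>R y' t = F (of_real t) (y t)"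
    and yR: "\<And>t. \<bar>t\<bar> < \<rho> \<Longrightarrow> y t \<in> ball 0 R"
    and close: "\<And>t. \<bar>t\<bar> < \<rho> \<Longrightarrow> norm (y t - p (of_real t)) \<le> D * \<bar>t\<bar> ^ m"
    and "D \<ge> 0" and t: "\<bar>t\<bar> < \<rho>"
  shows "norm (y t - W n (of_real t)) \<le> D * (1 / 2) ^ n * \<bar>t\<bar> ^ m"
  using t
proof (induction n arbitrary: t)
  case 0
  then show ?case using close W(1) by simp
next
  case (Suc n t)
  have "\<rho> > 0" using Suc.prems by linarith
  obtain V' where V': "\<And>z j. z \<in> ball 0 \<rho> \<Longrightarrow>
      ((\<lambda>z. W (Suc n) z $ j) has_field_derivative V' z $ j) (at z)"
    "\<And>z. z \<in> ball 0 \<rho> \<Longrightarrow> z *s V' z = F z (W n z)"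
    using picard_stepE[OF W(3)[of n]] by blast
  show ?case
  proof (rule radial_growth_bound[where v = "\<lambda>t. y t - W (Suc n) (of_real t)"
        and v' = "\<lambda>t. y' t - V' (of_real t)" and \<rho> = \<rho>])
    \<comment> \<open>Both values equal \<open>p 0\<close>, as the weight in \<open>close\<close>
      and in admissibility vanishes at 0.\<close>
    show "y 0 - W (Suc n) (of_real 0) = 0"
      using close[of 0] m(1) admissible_zero[OF W(2)] \<open>\<rho> > 0\<close> by (simp add: zero_power)
    fix s :: real assume s: "\<bar>s\<bar> < \<rho>"
    then have \<zeta>: "complex_of_real s \<in> ball 0 \<rho>" by simp
    show "((\<lambda>t. y t - W (Suc n) (of_real t)) has_vector_derivative y' s - V' (of_real s)) (at s)"
      by (intro has_vector_derivative_diff y s has_vector_derivative_of_real_compose_vec V'(1) \<zeta>)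
    have "norm (F (of_real s) (y s) - F (of_real s) (W n (of_real s)))
        \<le> real m * (D * (1 / 2) ^ n / 2) * \<bar>s\<bar> ^ m"
      using Suc.IH[OF s] \<open>D \<ge> 0\<close>
      by (intro half_contraction admissible_in_ball[OF W(2)] \<zeta> yR s) auto
    moreover have "s *\<^sub>R V' (of_real s) = of_real s *s V' (of_real s)"
      unfolding vec_eq_iff vector_scaleR_component vector_smult_component
      by (simp add: scaleR_conv_of_real)
    ultimately show "norm (s *\<^sub>R (y' s - V' (of_real s))) \<le> real m * (D * (1 / 2) ^ Suc n) * \<bar>s\<bar> ^ m"
      by (simp add: scaleR_diff_right ode[OF s] V'(2)[OF \<zeta>])
  qed (use Suc.prems m in auto)
qed

lemma real_solution_extends:
  assumes "\<rho> > 0"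
    and y: "\<And>t. \<bar>t\<bar> < \<rho> \<Longrightarrow> (y has_vector_derivative y' t) (at t)"
    and ode: "\<And>t. \<bar>t\<bar> < \<rho> \<Longrightarrow> t *\<^sub>R y' t = F (of_real t) (y t)"
    and yR: "\<And>t. \<bar>t\<bar> < \<rho> \<Longrightarrow> y t \<in> ball 0 R"
    and close: "\<And>t. \<bar>t\<bar> < \<rho> \<Longrightarrow> norm (y t - p (of_real t)) \<le> D * \<bar>t\<bar> ^ m"
    and "D \<ge> 0"
  obtains G where "\<And>j. (\<lambda>z. G z $ j) holomorphic_on ball 0 \<rho>"
    "\<And>t. \<bar>t\<bar> < \<rho> \<Longrightarrow> y t = G (of_real t)"
proof -
  obtain W where W: "W 0 = p" "\<And>n. admissible (W n)" "\<And>n. picard_step (W n) (W (Suc n))"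
    using picard_sequence_exists[OF \<open>\<rho> > 0\<close>] by metis
  obtain G where G: "\<And>j. (\<lambda>z. G z $ j) holomorphic_on ball 0 \<rho>"
    "\<And>z. z \<in> ball 0 \<rho> \<Longrightarrow> (\<lambda>n. W n z) \<longlonglongrightarrow> G z"
    using picard_limit[OF W] by metis
  have "y t = G (of_real t)" if t: "\<bar>t\<bar> < \<rho>" for t
  proof -
    have "(\<lambda>n. y t - W n (of_real t)) \<longlonglongrightarrow> 0"
    proof (rule Lim_null_comparison)
      show "\<forall>\<^sub>F n in sequentially. norm (y t - W n (of_real t)) \<le> D * (1 / 2) ^ n * \<bar>t\<bar> ^ m"
        using picard_real_bound[OF W y ode yR close \<open>D \<ge> 0\<close> t] by simp
      show "(\<lambda>n. D * (1 / 2) ^ n * \<bar>t\<bar> ^ m) \<longlonglongrightarrow> 0"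
        by (intro tendsto_mult_left_zero tendsto_mult_right_zero LIMSEQ_power_zero) simp
    qed
    moreover have "(\<lambda>n. y t - W n (of_real t)) \<longlonglongrightarrow> y t - G (of_real t)"
      using t by (intro tendsto_diff tendsto_const G(2)) simp
    ultimately have "y t - G (of_real t) = 0" using LIMSEQ_unique by blast
    then show ?thesis by simp
  qed
  with G(1) show thesis by (rule that)
qed

end

subsection \<open>Analyticity of smooth solutions\<close>

lemma real_analytic_on_holomorphic_restriction:
  fixes G :: "complex \<Rightarrow> complex^'n"
  assumes G: "\<And>j. (\<lambda>z. G z $ j) holomorphic_on ball 0 \<rho>"
    and y: "\<And>t. \<bar>t\<bar> < \<rho> \<Longrightarrow> y t = G (of_real t)"
  shows "real_analytic_on (ball 0 \<rho>) y"
  unfolding real_analytic_on_def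
proof
  fix t0 :: real assume t0: "t0 \<in> ball 0 \<rho>"
  \<comment> \<open>Taylor coefficients of the components at the real centre; the series converges
    on the disc of radius \<open>\<rho> - \<bar>t0\<bar>\<close>, which lies inside
    \<open>ball 0 \<rho>\<close>.\<close>
  define a where "a k = (\<chi> j. (deriv ^^ k) (\<lambda>z. G z $ j) (of_real t0) / fact k)" for k
  have "(\<lambda>k. (t - t0) ^ k *\<^sub>R a k) sums y t" if t: "\<bar>t - t0\<bar> < \<rho> - \<bar>t0\<bar>" for t
  proof -
    have sub: "ball (complex_of_real t0) (\<rho> - \<bar>t0\<bar>) \<subseteq> ball 0 \<rho>"
      by (rule ball_subset_ball_iff[THEN iffD2]) simp
    have "(\<lambda>k. ((t - t0) ^ k *\<^sub>R a k) $ j) sums (y t $ j)" for j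
    proof -
      have "(\<lambda>k. (deriv ^^ k) (\<lambda>z. G z $ j) (of_real t0) / fact k * (of_real t - of_real t0) ^ k)
          sums G (of_real t) $ j"
      proof (rule holomorphic_power_series)
        show "(\<lambda>z. G z $ j) holomorphic_on ball (of_real t0) (\<rho> - \<bar>t0\<bar>)"
          using G sub by (rule holomorphic_on_subset)
        show "complex_of_real t \<in> ball (of_real t0) (\<rho> - \<bar>t0\<bar>)"
          using t by (simp add: dist_of_real dist_real_def abs_minus_commute)
      qed
      moreover have "y t = G (of_real t)" using t by (intro y) linarith
      ultimately show ?thesis
        unfolding vector_scaleR_component by (simp add: a_def scaleR_conv_of_real mult_ac)
    qed
    then show ?thesis
      unfolding sums_def by (intro vec_tendstoI) (simp add: sum_component)
  qed
  then show "\<exists>e>0. \<exists>a. \<forall>t. \<bar>t - t0\<bar> < e \<longrightarrow> (\<lambda>k. (t - t0) ^ k *\<^sub>R a k) sums y t"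
    using t0 by (intro exI[of _ "\<rho> - \<bar>t0\<bar>"]) auto
qed

text \<open>Take the smallest of the finitely many radii and the sum of the constants, as the norm
  of a vector is at most the sum of its component norms.\<close>

lemma holomorphic_several_family_Lipschitz:
  fixes f :: "'n::finite \<Rightarrow> complex \<Rightarrow> complex^'n \<Rightarrow> complex"
  assumes f: "\<And>j. holomorphic_several (\<lambda>(z, w). f j z w) U" and 0: "(0, 0) \<in> U"
  obtains R L where "R > 0" "L \<ge> 0" "ball 0 R \<times> ball 0 R \<subseteq> U"
    "\<And>z v w. \<lbrakk>z \<in> ball 0 R; v \<in> ball 0 R; w \<in> ball 0 R\<rbrakk>
      \<Longrightarrow> norm ((\<chi> j. f j z v) - (\<chi> j. f j z w)) \<le> L * norm (v - w)"
proof -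
  have "\<exists>R L. R > 0 \<and> L \<ge> 0 \<and> ball 0 R \<times> ball 0 R \<subseteq> U \<and>
      (\<forall>z\<in>ball 0 R. \<forall>v\<in>ball 0 R. \<forall>w\<in>ball 0 R. norm (f j z v - f j z w) \<le> L * norm (v - w))" for j
    using holomorphic_several_locally_Lipschitz[OF f 0, of j] unfolding case_prod_conv by metis
  then obtain R L where R: "\<And>j. R j > (0::real)" and L: "\<And>j. L j \<ge> (0::real)"
    and U: "\<And>j. ball 0 (R j) \<times> ball 0 (R j) \<subseteq> U"
    and Lip: "\<And>j z v w. \<lbrakk>z \<in> ball 0 (R j); v \<in> ball 0 (R j); w \<in> ball 0 (R j)\<rbrakk>
      \<Longrightarrow> norm (f j z v - f j z w) \<le> L j * norm (v - w)"
    by metis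
  define S where "S = Min (range R)"
  have S: "S \<le> R j" for j by (simp add: S_def)
  show thesis
  proof
    show "S > 0" using R by (simp add: S_def)
    show "0 \<le> (\<Sum>j\<in>UNIV. L j)" using L by (simp add: sum_nonneg)
    show "ball 0 S \<times> ball 0 S \<subseteq> U"
    proof -
      have "ball 0 S \<times> ball 0 S \<subseteq> ball 0 (R j) \<times> ball 0 (R j)" for j
        using S[of j] by (intro Sigma_mono subset_ball)
      then show ?thesis using U by blast
    qed
    fix z :: complex and v w :: "complex^'n"
    assume zvw: "z \<in> ball 0 S" "v \<in> ball 0 S" "w \<in> ball 0 S"
    have "norm (f j z v - f j z w) \<le> L j * norm (v - w)" for j
      using zvw S[of j] by (intro Lip) auto
    then have "(\<Sum>j\<in>UNIV. norm (f j z v - f j z w)) \<le> (\<Sum>j\<in>UNIV. L j) * norm (v - w)"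
      unfolding sum_distrib_right by (rule sum_mono)
    then show "norm ((\<chi> j. f j z v) - (\<chi> j. f j z w)) \<le> (\<Sum>j\<in>UNIV. L j) * norm (v - w)"
      using norm_le_sum_norm_nth[of "(\<chi> j. f j z v) - (\<chi> j. f j z w)"] by simp
  qed
qed

lemma isCont_bounded_near_zero:
  fixes h :: "'a::real_normed_vector \<Rightarrow> real"
  assumes "isCont h 0" "h 0 < B"
  obtains d where "d > 0" "\<And>x. norm x < d \<Longrightarrow> h x < B"
proof -
  have "\<forall>\<^sub>F x in nhds 0. h x < B"
    using assms order_tendstoD(2)[of h "h 0" "nhds 0" B] by (simp add: continuous_at tendsto_nhds_iff isCont_def)
  then show thesis
    using that by (auto simp: eventually_nhds_metric dist_norm)
qed

text \<open>Carries a growth order from the positive real axis to a complex disc: each component is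
  \<open>z ^ m\<close> times a holomorphic function, which is bounded on the smaller closed
  disc.\<close>

lemma vec_holomorphic_growth:
  fixes q :: "complex \<Rightarrow> complex^'n"
  assumes q: "\<And>j. (\<lambda>z. q z $ j) holomorphic_on ball 0 \<rho>"
    and bd: "\<And>t. 0 < t \<Longrightarrow> t < \<rho> \<Longrightarrow> norm (q (of_real t)) \<le> C * t ^ m"
    and "\<rho>' < \<rho>" "\<rho> > 0"
  obtains B where "B \<ge> 0" "\<And>z. norm z < \<rho>' \<Longrightarrow> norm (q z) \<le> B * norm z ^ m"
proof -
  have "\<exists>B\<ge>0. \<forall>z. norm z < \<rho>' \<longrightarrow> norm (q z $ j) \<le> B * norm z ^ m" for j
  proof -
    have "norm (q (of_real t) $ j) \<le> C * t ^ m" if "0 < t" "t < \<rho>" for t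
      using bd[OF that] order_trans[OF Finite_Cartesian_Product.norm_nth_le] by blast
    from holomorphic_factor_power[OF q \<open>\<rho> > 0\<close> this] obtain h
      where h: "h holomorphic_on ball 0 \<rho>" and fac: "\<forall>z\<in>ball 0 \<rho>. q z $ j = z ^ m * h z"
      by blast
    have "cball 0 \<rho>' \<subseteq> ball (0::complex) \<rho>" using \<open>\<rho>' < \<rho>\<close> by auto
    then have "continuous_on (cball 0 \<rho>') h"
      using h holomorphic_on_imp_continuous_on continuous_on_subset by blast
    then have "bounded (h ` cball 0 \<rho>')"
      by (intro compact_imp_bounded compact_continuous_image) auto
    then obtain B where "B > 0" and B: "\<And>z. z \<in> cball 0 \<rho>' \<Longrightarrow> norm (h z) \<le> B"
      unfolding bounded_pos by (metis imageI)
    have "norm (q z $ j) \<le> B * norm z ^ m" if "norm z < \<rho>'" for z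
      using fac B[of z] that \<open>\<rho>' < \<rho>\<close>
      by (simp add: norm_mult norm_power mult.commute[of B] mult_left_mono)
    then show ?thesis using \<open>B > 0\<close> by (intro exI[of _ B]) auto
  qed
  then obtain B where B: "\<And>j. B j \<ge> 0" "\<And>j z. norm z < \<rho>' \<Longrightarrow> norm (q z $ j) \<le> B j * norm z ^ m"
    by metis
  show thesis
  proof
    show "0 \<le> (\<Sum>j\<in>UNIV. B j)" using B(1) by (simp add: sum_nonneg)
    fix z :: complex assume "norm z < \<rho>'"
    then have "(\<Sum>j\<in>UNIV. norm (q z $ j)) \<le> (\<Sum>j\<in>UNIV. B j) * norm z ^ m"
      unfolding sum_distrib_right by (intro sum_mono B(2))
    then show "norm (q z) \<le> (\<Sum>j\<in>UNIV. B j) * norm z ^ m"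
      using norm_le_sum_norm_nth[of "q z"] by linarith
  qed
qed

theorem theorem5p1:
  fixes y :: "real \<Rightarrow> complex^'n"
    and f :: "'n \<Rightarrow> complex \<Rightarrow> complex^'n \<Rightarrow> complex"
    and U :: "(complex \<times> (complex^'n)) set"
    and r :: real
  assumes "r > 0"
    and "smooth_on (ball 0 r) y"
    and "y 0 = 0"
    and "(0, 0) \<in> U"
    and "\<And>j. holomorphic_several (\<lambda>(z, w). f j z w) U"
    and "\<And>t j. \<bar>t\<bar> < r \<Longrightarrow>
           t *\<^sub>R vector_derivative (\<lambda>s. y s $ j) (at t) = f j (complex_of_real t) (y t)"
  shows "\<exists>e>0. real_analytic_on (ball 0 e) y"
proof -
  define F where "F z w = (\<chi> j. f j z w)" for z w
  define y' where "y' t = vector_derivative y (at t)" for t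
  have y: "(y has_vector_derivative y' t) (at t)" if "\<bar>t\<bar> < r" for t
    unfolding y'_def using that by (intro smooth_on_has_vector_derivative[OF assms(2)]) simp
  have ode: "t *\<^sub>R y' t = F (of_real t) (y t)" if "\<bar>t\<bar> < r" for t
  proof -
    have "vector_derivative (\<lambda>s. y s $ j) (at t) = y' t $ j" for j
      using bounded_linear.has_vector_derivative[OF bounded_linear_vec_nth y[OF that]]
      by (rule vector_derivative_at)
    then show ?thesis
      using assms(6)[OF that] by (simp add: F_def vec_eq_iff)
  qed
  obtain R L where "R > 0" "L \<ge> 0" and RU: "ball 0 R \<times> ball 0 R \<subseteq> U"
    and Lip: "\<And>z v w. \<lbrakk>z \<in> ball 0 R; v \<in> ball 0 R; w \<in> ball 0 R\<rbrakk>
      \<Longrightarrow> norm (F z v - F z w) \<le> L * norm (v - w)"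
    by (rule holomorphic_several_family_Lipschitz[of f U, OF assms(5,4), folded F_def])
      (assumption | rule that)+
  \<comment> \<open>\<open>k\<close> already dominates \<open>2 * L\<close>. Approximating
    \<open>y'\<close> to order \<open>k\<close> yields order \<open>m = Suc k\<close> for
    \<open>y\<close>, and the successor keeps \<open>m\<close> positive even when
    \<open>L = 0\<close>.\<close>
  define k where "k = nat \<lceil>2 * L\<rceil>"
  define m where "m = Suc k"
  have m: "m > 0" "2 * L \<le> real m" 
    using real_nat_ceiling_ge[of "2 * L"] unfolding m_def k_def by auto
  have "r / 2 < r" using \<open>r > 0\<close> by simp
  \<comment> \<open>The approximation starts at \<open>y'\<close>, so that its primitive
    \<open>p\<close> is close to \<open>y\<close> while \<open>p' = q\<close> stays close to
    \<open>y'\<close>. Halving \<open>r\<close> gives the strictly smaller radius required.\<close>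
  obtain q C where q: "\<And>j. (\<lambda>z. q z $ j) holomorphic_on UNIV"
    and q_close: "\<And>t. \<bar>t\<bar> < r / 2 \<Longrightarrow> norm (y' t - q (of_real t)) \<le> C * \<bar>t\<bar> ^ k"
    using smooth_on_entire_approximation[OF smooth_on_vector_derivative[OF assms(2)] \<open>r / 2 < r\<close>, of k]
    unfolding y'_def by blast
  have y_half: "(y has_vector_derivative y' t) (at t)" if "\<bar>t\<bar> < r / 2" for t
    using that by (intro y) simp
  obtain p where p: "\<And>z j. ((\<lambda>z. p z $ j) has_field_derivative q z $ j) (at z)" and p0: "p 0 = 0"
    and p_close: "\<And>t. \<bar>t\<bar> < r / 2 \<Longrightarrow> norm (y t - p (of_real t)) \<le> C / real m * \<bar>t\<bar> ^ m"
    by (rule primitive_approximation[of "r / 2" y y' q, OF y_half q q_close, folded m_def, unfolded assms(3)])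
      (assumption | rule that)+
  have p_cont: "isCont p z" for z by (rule isCont_vec_holomorphic[OF p])

  \<comment> \<open>The absolute value secures a nonnegative constant, since the sign of
    \<open>C\<close> is unknown.\<close>
  define D where "D = \<bar>C\<bar> / real m"
  have "D \<ge> 0" by (simp add: D_def)
  have p_close': "norm (y t - p (of_real t)) \<le> D * \<bar>t\<bar> ^ m" if "\<bar>t\<bar> < r / 2" for t
    by (rule order_trans[OF p_close[OF that]]) (auto simp: D_def intro!: mult_right_mono divide_right_mono)
  have "\<exists>d>0. \<forall>z. norm z < d \<longrightarrow> norm (p z) < R"
    using isCont_bounded_near_zero[of "\<lambda>z. norm (p z)" R] p_cont[of 0] \<open>R > 0\<close> p0
    by (metis continuous_norm norm_zero)
  then obtain d1 where d1: "d1 > 0" "\<And>z. norm z < d1 \<Longrightarrow> norm (p z) < R" by blast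
  have "isCont y 0" using \<open>r > 0\<close> by (intro has_vector_derivative_continuous[OF y]) simp
  then have "\<exists>d>0. \<forall>t. norm t < d \<longrightarrow> norm (y t) < R"
    using isCont_bounded_near_zero[of "\<lambda>z. norm (y z)" R] \<open>R > 0\<close> assms(3)
    by (metis continuous_norm norm_zero)
  then obtain d2 where d2: "d2 > 0" "\<And>t. norm t < d2 \<Longrightarrow> norm (y t) < R" by blast
  \<comment> \<open>\<open>R\<close> serves the Lipschitz bound in \<open>z\<close>,
    \<open>r / 2\<close> the approximations, and \<open>d1\<close> and \<open>d2\<close> keep
    \<open>p\<close> and \<open>y\<close> inside \<open>ball 0 R\<close>.\<close>
  define \<rho>1 where "\<rho>1 = Min {R, r / 2, d1, d2}"
  have \<rho>1: "\<rho>1 > 0" "\<rho>1 \<le> R" "\<rho>1 \<le> r / 2" "\<rho>1 \<le> d1" "\<rho>1 \<le> d2"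
    using \<open>R > 0\<close> \<open>r > 0\<close> d1 d2 by (auto simp: \<rho>1_def)

  define e where "e z = F z (p z) - z *s q z" for z
  have e_hol: "(\<lambda>z. e z $ j) holomorphic_on ball 0 \<rho>1" for j
  proof -
    have "(\<lambda>z. (\<lambda>(z, w). f j z w) (z, p z)) holomorphic_on ball 0 \<rho>1"
    proof (rule holomorphic_several_compose[OF assms(5) open_ball])
      show "(\<lambda>z. p z $ i) holomorphic_on ball 0 \<rho>1" for i
        using p holomorphic_on_open[OF open_ball] by blast
      show "(z, p z) \<in> U" if "z \<in> ball 0 \<rho>1" for z
        using that \<rho>1 d1(2)[of z] RU by auto
    qed auto
    moreover have "(\<lambda>z. q z $ j) holomorphic_on ball 0 \<rho>1"
      using q by (rule holomorphic_on_subset) simp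
    ultimately show ?thesis
      by (auto simp: e_def F_def intro!: holomorphic_intros)
  qed
  \<comment> \<open>Subtracting the equation for \<open>y\<close> leaves a Lipschitz difference and
    \<open>t\<close> times the error of \<open>q\<close>; the extra factor \<open>t\<close> lifts
    order \<open>k\<close> to \<open>m\<close>.\<close>
  have e_real: "norm (e (of_real t)) \<le> (L * D + \<bar>C\<bar>) * t ^ m" if t: "0 < t" "t < \<rho>1" for t
  proof -
    have "e (of_real t) = (F (of_real t) (p (of_real t)) - F (of_real t) (y t)) + t *\<^sub>R (y' t - q (of_real t))"
    proof -
      have "of_real t *s q (of_real t) = t *\<^sub>R q (of_real t)"
        unfolding vec_eq_iff vector_scaleR_component vector_smult_component
        by (simp add: scaleR_conv_of_real)
      then show ?thesis
        using ode[of t] t \<rho>1 \<open>r > 0\<close> by (simp add: e_def scaleR_diff_right)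
    qed
    moreover have "norm (F (of_real t) (p (of_real t)) - F (of_real t) (y t)) \<le> L * D * t ^ m"
    proof -
      have "norm (F (of_real t) (p (of_real t)) - F (of_real t) (y t)) \<le> L * norm (p (of_real t) - y t)"
        using t \<rho>1 d1(2)[of "of_real t"] d2(2)[of t] by (intro Lip) auto
      also have "\<dots> \<le> L * (D * t ^ m)"
        using p_close'[of t] t \<rho>1 \<open>L \<ge> 0\<close> by (intro mult_left_mono) (auto simp: norm_minus_commute)
      finally show ?thesis by simp
    qed
    moreover have "norm (t *\<^sub>R (y' t - q (of_real t))) \<le> \<bar>C\<bar> * t ^ m"
    proof -
      have "norm (t *\<^sub>R (y' t - q (of_real t))) \<le> t * (C * t ^ k)"
        using q_close[of t] t \<rho>1 by (simp add: mult_left_mono)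
      also have "\<dots> \<le> t * (\<bar>C\<bar> * t ^ k)"
        using t by (intro mult_left_mono mult_right_mono) auto
      finally show ?thesis by (simp add: m_def mult_ac)
    qed
    ultimately show ?thesis
      using norm_triangle_ineq by (smt (verit) distrib_right)
  qed
  have "\<rho>1 / 2 < \<rho>1" using \<rho>1 by simp
  obtain B where "B \<ge> 0" and B: "\<And>z. norm z < \<rho>1 / 2 \<Longrightarrow> norm (e z) \<le> B * norm z ^ m"
    by (rule vec_holomorphic_growth[of e \<rho>1, OF e_hol e_real \<open>\<rho>1 / 2 < \<rho>1\<close> \<rho>1(1)])
      (assumption | rule that)+
  \<comment> \<open>Normalises the residual bound \<open>B\<close> to the form
    \<open>real m * A\<close> used by the locale.\<close>
  define A where "A = B / real m"
  have "A \<ge> 0" using \<open>B \<ge> 0\<close> by (simp add: A_def)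

  \<comment> \<open>The tube condition involves \<open>A\<close>, so the last shrinking of the disc
    comes only now; at 0 the expression vanishes, and continuity supplies the radius
    \<open>d3\<close>.\<close>
  have "isCont (\<lambda>z. norm (p z) + 2 * A * norm z ^ m) 0"
    by (intro continuous_intros p_cont)
  moreover have "norm (p 0) + 2 * A * norm (0 :: complex) ^ m < R"
    using p0 m(1) \<open>R > 0\<close> by (simp add: zero_power)
  ultimately obtain d3 where d3: "d3 > 0" "\<And>z. norm z < d3 \<Longrightarrow> norm (p z) + 2 * A * norm z ^ m < R"
    using isCont_bounded_near_zero[of "\<lambda>z. norm (p z) + 2 * A * norm z ^ m" R] by metis
  define \<rho> where "\<rho> = min (\<rho>1 / 2) d3"
  have \<rho>: "\<rho> > 0" "\<rho> \<le> \<rho>1 / 2" "\<rho> \<le> d3" using \<rho>1 d3 by (auto simp: \<rho>_def)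
  interpret briot_bouquet_approximation F U p q m \<rho> R L A
  proof
    show "holomorphic_several (\<lambda>(z, w). F z w $ j) U" for j
      using assms(5) by (simp add: F_def)
    show "ball 0 \<rho> \<times> ball 0 R \<subseteq> U"
      using RU \<rho> \<rho>1 by (auto simp: subset_iff)
    show "norm (F z v - F z w) \<le> L * norm (v - w)"
      if "z \<in> ball 0 \<rho>" "v \<in> ball 0 R" "w \<in> ball 0 R" for z v w
      using that \<rho> \<rho>1 by (intro Lip) auto
    show "norm (p z) + 2 * A * norm z ^ m < R" if "z \<in> ball 0 \<rho>" for z
      using that \<rho> by (intro d3) auto
    show "norm (F z (p z) - z *s q z) \<le> real m * A * norm z ^ m" if "z \<in> ball 0 \<rho>" for z
      using B[of z] that \<rho> m(1) by (simp add: e_def A_def)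
  qed (use p m \<open>L \<ge> 0\<close> \<open>A \<ge> 0\<close> in auto)
  obtain G where "\<And>j. (\<lambda>z. G z $ j) holomorphic_on ball 0 \<rho>"
    "\<And>t. \<bar>t\<bar> < \<rho> \<Longrightarrow> y t = G (of_real t)"
  proof (rule real_solution_extends[of y y' D])
    fix t :: real assume t: "\<bar>t\<bar> < \<rho>"
    show "(y has_vector_derivative y' t) (at t)"
      and "t *\<^sub>R y' t = F (of_real t) (y t)"
      and "y t \<in> ball 0 R"
      and "norm (y t - p (of_real t)) \<le> D * \<bar>t\<bar> ^ m"
      using t \<rho> \<rho>1 y[of t] ode[of t] p_close'[of t] d2(2)[of t] by auto
  qed (use \<rho> \<open>D \<ge> 0\<close> in auto)
  then have "real_analytic_on (ball 0 \<rho>) y"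
    by (rule real_analytic_on_holomorphic_restriction)
  with \<rho>(1) show ?thesis by blast
qed

end
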